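(* Let $\Omega$ be a base space of locally integrable matrix functions as in the context. If for some $\omega\in\Omega$ the equation $\dot x=A(\omega_t)x$ has (uniform) $\mu$-dichotomy for some fast growth rate $\mu$ (equivalently, $0\notin\Sigma_{\mu\mathrm{D}}(\omega)$), then $\Omega$ is not compact.
   Context: Skew-product setting. $\Omega$ is a space of locally integrable functions $\omega:\mathbb{R}\to\mathbb{R}^{N\times N}$, endowed with a topology such that the translation flow $\mathbb{R}\times\Omega\to\Omega$, $(\tau,\omega)\mapsto\omega_\tau$, $\omega_\tau(t)=\omega(t+\tau)$, is well defined and continuous; the evaluation map $A:\Omega\to\mathbb{R}^{N\times N}$, $A(\omega)=\omega(0)$, is continuous (so $A(\omega_t)=\omega(t)$); if $\widehat\omega=\lim_n\omega_{\tau_n}$ in $\Omega$ with $\tau_n\searrow-\infty$ or $\tau_n\nearrow+\infty$, then $\widehat\omega(t)=\lim_n\omega_{\tau_n}(t)$ for almost every $t$; and $(\omega,t,s)\mapsto\Phi_\omega(t,s)$ is jointly continuous, where $\Phi_\omega(t,s)$ denotes the evolution operator of $\dot x=A(\omega_t)x$. Growth rates. A growth rate is a strictly increasing differentiable function $\mu:\mathbb{R}\to\mathbb{R}^+$ with $\mu(0)=1$, $\lim_{t\to+\infty}\mu(t)=+\infty$, $\lim_{t\to-\infty}\mu(t)=0$. For $r>1$ let $\mathrm{s}_r(t)=e^{\mathrm{sgn}(t)|t|^r}$. The growth rate $\mu$ is fast if there are $r\in(1,+\infty)$ and $M\ge1$ with $\frac{\mathrm{s}_r(t)}{\mathrm{s}_r(s)}\le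 M\frac{\mu(t)}{\mu(s)}$ for all $t\ge s$. Dichotomy. A linear equation $\dot x=B(t)x$ ($B$ locally integrable) with evolution operator $\Phi$ has (uniform) $\mu$-dichotomy if there are projections $\mathrm{P}(s)\in\mathbb{R}^{N\times N}$, $s\in\mathbb{R}$, with $\mathrm{P}(t)\Phi(t,s)=\Phi(t,s)\mathrm{P}(s)$ for all $t,s$, and constants $K\ge1$, $\alpha<0$, $\beta>0$ such that $\|\Phi(t,s)\mathrm{P}(s)\|\le K(\mu(t)/\mu(s))^\alpha$ for $t\ge s$ and $\|\Phi(t,s)[\mathrm{Id}-\mathrm{P}(s)]\|\le K(\mu(t)/\mu(s))^\beta$ for $t\le s$. For real $\gamma$, $\gamma\in\Sigma_{\mu\mathrm{D}}(\omega)$ means that the shifted equation $\dot y=\big(\omega(t)-\gamma\frac{\dot\mu(t)}{\mu(t)}\mathrm{Id}\big)y$ does not have $\mu$-dichotomy. *)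

theory Defs
  imports "HOL-Analysis.Analysis"
begin

definition locally_integrable :: "(real \<Rightarrow> real^'n^'n) \<Rightarrow> bool" where
  "locally_integrable B \<longleftrightarrow> (\<forall>a b. B absolutely_integrable_on {a..b})"

text \<open>
  Solutions are Caratheodory solutions, that is, solutions of the integral equation
  \<open>\<Phi> t s = Id + (integral of B u ** \<Phi> u s for u from s to t)\<close>; the case \<open>t \<le> s\<close> is the
  oriented integral. For locally integrable \<open>B\<close> there is exactly one such \<open>\<Phi>\<close>.
\<close>

definition evolution_operator ::
  "(real \<Rightarrow> real^'n^'n) \<Rightarrow> (real \<Rightarrow> real \<Rightarrow> real^'n^'n) \<Rightarrow> bool" where
  "evolution_operator B \<Phi> \<longleftrightarrow>
     (\<forall>s t. s \<le> t \<longrightarrow> ((\<lambda>u. B u ** \<Phi> u s) has_integral (\<Phi> t s - mat 1)) {s..t}) \<and>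
     (\<forall>s t. t \<le> s \<longrightarrow> ((\<lambda>u. B u ** \<Phi> u s) has_integral (mat 1 - \<Phi> t s)) {t..s})"

definition translate :: "real \<Rightarrow> (real \<Rightarrow> real^'n^'n) \<Rightarrow> (real \<Rightarrow> real^'n^'n)" where
  "translate \<tau> \<omega> = (\<lambda>t. \<omega> (t + \<tau>))"

definition eval0 :: "(real \<Rightarrow> real^'n^'n) \<Rightarrow> real^'n^'n" where
  "eval0 \<omega> = \<omega> 0"

text \<open>
  The space \<open>\<Omega>\<close> is the carrier \<open>topspace X\<close> of an abstract topology \<open>X\<close>. Its elements are
  genuine functions, not classes modulo null sets, since they are evaluated at points.
\<close>

definition base_space :: "(real \<Rightarrow> real^'n^'n) topology \<Rightarrow> bool" where
  "base_space X \<longleftrightarrow>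
     (\<forall>\<omega> \<in> topspace X. locally_integrable \<omega>) \<and>
     continuous_map (prod_topology euclideanreal X) X (\<lambda>(\<tau>, \<omega>). translate \<tau> \<omega>) \<and>
     continuous_map X euclidean eval0 \<and>
     (\<forall>\<omega> \<in> topspace X. \<forall>\<omega>' \<tau>.
        (decseq \<tau> \<and> filterlim \<tau> at_bot sequentially \<or>
         incseq \<tau> \<and> filterlim \<tau> at_top sequentially) \<and>
        limitin X (\<lambda>n. translate (\<tau> n) \<omega>) \<omega>' sequentially \<longrightarrow>
        (AE t in lebesgue. (\<lambda>n. translate (\<tau> n) \<omega> t) \<longlonglongrightarrow> \<omega>' t)) \<and>
     (\<exists>\<Phi>. (\<forall>\<omega> \<in> topspace X. evolution_operator (\<lambda>t. eval0 (translate t \<omega>)) (\<Phi> \<omega>)) \<and>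
          continuous_map (prod_topology X (prod_topology euclideanreal euclideanreal)) euclidean
            (\<lambda>(\<omega>, t, s). \<Phi> \<omega> t s))"

definition growth_rate :: "(real \<Rightarrow> real) \<Rightarrow> bool" where
  "growth_rate \<mu> \<longleftrightarrow>
     strict_mono \<mu> \<and> (\<forall>t. \<mu> differentiable (at t)) \<and> (\<forall>t. \<mu> t > 0) \<and> \<mu> 0 = 1 \<and>
     filterlim \<mu> at_top at_top \<and> (\<mu> \<longlongrightarrow> 0) at_bot"

definition s_rate :: "real \<Rightarrow> real \<Rightarrow> real" where
  "s_rate r t = exp (sgn t * \<bar>t\<bar> powr r)"

definition fast_growth_rate :: "(real \<Rightarrow> real) \<Rightarrow> bool" where
  "fast_growth_rate \<mu> \<longleftrightarrow> growth_rate \<mu> \<and>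
     (\<exists>r>1. \<exists>M\<ge>1. \<forall>s t. s \<le> t \<longrightarrow> s_rate r t / s_rate r s \<le> M * (\<mu> t / \<mu> s))"

text \<open>
  Matrices are measured in the operator norm induced by the Euclidean norm. The choice of norm
  only affects the constant \<open>K\<close>.
\<close>

definition mu_dichotomy :: "(real \<Rightarrow> real) \<Rightarrow> (real \<Rightarrow> real^'n^'n) \<Rightarrow> bool" where
  "mu_dichotomy \<mu> B \<longleftrightarrow>
     (\<exists>\<Phi> P. evolution_operator B \<Phi> \<and>
        (\<forall>s. P s ** P s = P s) \<and>
        (\<forall>t s. P t ** \<Phi> t s = \<Phi> t s ** P s) \<and>
        (\<exists>K \<alpha> \<beta>. K \<ge> 1 \<and> \<alpha> < 0 \<and> \<beta> > 0 \<and>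
           (\<forall>t s. s \<le> t \<longrightarrow> onorm ((*v) (\<Phi> t s ** P s)) \<le> K * (\<mu> t / \<mu> s) powr \<alpha>) \<and>
           (\<forall>t s. t \<le> s \<longrightarrow> onorm ((*v) (\<Phi> t s ** (mat 1 - P s))) \<le> K * (\<mu> t / \<mu> s) powr \<beta>)))"

definition mu_spectrum :: "(real \<Rightarrow> real) \<Rightarrow> (real \<Rightarrow> real^'n^'n) \<Rightarrow> real set" where
  "mu_spectrum \<mu> \<omega> =
     {\<gamma>. \<not> mu_dichotomy \<mu> (\<lambda>t. \<omega> t - (\<gamma> * (deriv \<mu> t / \<mu> t)) *\<^sub>R mat 1)}"

end

theory Submission imports Defs begin

text \<open>
  On a compact \<open>\<Omega>\<close> the evaluation map is bounded, so all coefficients along an orbit are bounded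
  by a common constant \<open>C\<close>. Over a time step \<open>\<delta>\<close> with \<open>C * \<delta> \<le> 1/2\<close> a solution then changes
  its norm at most by the factor 2, forwards and backwards. For a fast growth rate, however,
  \<open>\<mu> (s + \<delta>) / \<mu> s\<close> tends to infinity, so the dichotomy estimates contract by more than
  the factor 2 on the range of \<open>P s\<close> forwards and on the kernel of \<open>P (s + \<delta>)\<close>
  backwards. Hence both \<open>P s = 0\<close> and \<open>P s = Id\<close> for large \<open>s\<close>, which is absurd.
\<close>

text \<open>This replaces Gronwall's inequality. Let \<open>m\<close> maximize
  \<open>norm (f u)\<close> on the interval. The increment from \<open>d\<close> to \<open>m\<close>
  is at most \<open>C * (b - a) * norm (f m)\<close>, hence at most half the maximum, which can be
  absorbed on the left. The order of \<open>c\<close> and \<open>d\<close> does not enter, so the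
  bound holds in both time directions.\<close>

lemma solution_norm_le_double:
  fixes f g :: "real \<Rightarrow> 'a::euclidean_space"
  assumes g: "\<And>x y. a \<le> x \<Longrightarrow> x \<le> y \<Longrightarrow> y \<le> b \<Longrightarrow> (g has_integral (f y - f x)) {x..y}"
    and bound: "\<And>u. norm (g u) \<le> C * norm (f u)"
    and C: "0 \<le> C" "C * (b - a) \<le> 1/2"
    and c: "c \<in> {a..b}" and d: "d \<in> {a..b}"
  shows "norm (f c) \<le> 2 * norm (f d)"
proof -
  have ab: "a \<le> b" using c by simp
  \<comment> \<open>Continuity of \<open>f\<close>, required for the maximum, comes from its being
    an indefinite integral of \<open>g\<close>.\<close>
  have "g integrable_on {a..b}"
    using g[of a b] ab by (auto simp: integrable_on_def)
  then have "continuous_on {a..b} (\<lambda>y. f a + integral {a..y} g)"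
    by (intro continuous_intros indefinite_integral_continuous_1)
  moreover have "f a + integral {a..y} g = f y" if "y \<in> {a..b}" for y
    using integral_unique[OF g[of a y]] that by simp
  ultimately have "continuous_on {a..b} f"
    by (metis (no_types, lifting) continuous_on_cong)
  then have "continuous_on {a..b} (\<lambda>u. norm (f u))"
    by (intro continuous_intros)
  then obtain m where m: "m \<in> {a..b}" and max: "\<And>u. u \<in> {a..b} \<Longrightarrow> norm (f u) \<le> norm (f m)"
    using continuous_attains_sup[of "{a..b}" "\<lambda>u. norm (f u)"] ab by auto
  have incr: "norm (f y - f x) \<le> norm (f m) / 2" if "a \<le> x" "x \<le> y" "y \<le> b" for x y
  proof -
    have "norm (g u) \<le> C * norm (f m)" if "u \<in> {x..y}" for u
      using bound[of u] max[of u] that \<open>a \<le> x\<close> \<open>y \<le> b\<close> C(1)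
      by (smt (verit) atLeastAtMost_iff mult_left_mono)
    then have "norm (f y - f x) \<le> (C * (y - x)) * norm (f m)"
      using has_integral_bound_real[OF _ _ g[OF that], of "C * norm (f m)" "{}"] that C(1)
      by (simp add: mult_ac)
    also have "\<dots> \<le> (C * (b - a)) * norm (f m)"
      using that C(1) by (intro mult_right_mono mult_left_mono) auto
    also have "\<dots> \<le> 1/2 * norm (f m)"
      using C(2) by (intro mult_right_mono) auto
    finally show ?thesis by simp
  qed
  have "norm (f m - f d) \<le> norm (f m) / 2"
    using incr[of d m] incr[of m d] m d
    by (cases "d \<le> m") (auto simp: norm_minus_commute)
  then show ?thesis
    using max[OF c] norm_triangle_sub[of "f m" "f d"] by simp
qed

lemma evolution_operator_refl:
  assumes "evolution_operator B \<Phi>"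
  shows "\<Phi> s s = mat 1"
proof -
  have "((\<lambda>u. B u ** \<Phi> u s) has_integral (\<Phi> s s - mat 1)) {s..s}"
    using assms unfolding evolution_operator_def by blast
  then have "\<Phi> s s - mat 1 = 0"
    by (rule has_integral_unique) (metis box_real(2) has_integral_refl(1))
  then show ?thesis
    by simp
qed

text \<open>The definition gives integrals with one end at \<open>s\<close>; additivity of the
  integral gives the others. With \<open>s\<close> outside the interior of the interval, a single
  orientation suffices in each case.\<close>

lemma evolution_operator_increment:
  assumes ev: "evolution_operator B \<Phi>" and xy: "x \<le> y" and s: "s \<le> x \<or> y \<le> s"
  shows "((\<lambda>u. B u ** \<Phi> u s) has_integral (\<Phi> y s - \<Phi> x s)) {x..y}"
proof -
  let ?g = "\<lambda>u. B u ** \<Phi> u s"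
  have fwd: "(?g has_integral (\<Phi> t s - mat 1)) {s..t}" if "s \<le> t" for t
    using ev that by (simp add: evolution_operator_def)
  have bwd: "(?g has_integral (mat 1 - \<Phi> t s)) {t..s}" if "t \<le> s" for t
    using ev that by (simp add: evolution_operator_def)
  from s show ?thesis
  proof
    assume sx: "s \<le> x"
    have int: "?g integrable_on {s..y}"
      using fwd[of y] sx xy by (auto simp: integrable_on_def)
    have "integral {s..x} ?g + integral {x..y} ?g = integral {s..y} ?g"
      using int sx xy by (intro Henstock_Kurzweil_Integration.integral_combine)
    then have "integral {x..y} ?g = \<Phi> y s - \<Phi> x s"
      using integral_unique[OF fwd[of x]] integral_unique[OF fwd[of y]] sx xy
      by (simp add: algebra_simps)
    moreover have "?g integrable_on {x..y}"
      using int by (rule integrable_subinterval_real) (use sx in auto)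
    ultimately show ?thesis
      by (metis integrable_integral)
  next
    assume ys: "y \<le> s"
    have int: "?g integrable_on {x..s}"
      using bwd[of x] ys xy by (auto simp: integrable_on_def)
    have "integral {x..y} ?g + integral {y..s} ?g = integral {x..s} ?g"
      using int ys xy by (intro Henstock_Kurzweil_Integration.integral_combine)
    then have "integral {x..y} ?g = \<Phi> y s - \<Phi> x s"
      using integral_unique[OF bwd[of x]] integral_unique[OF bwd[of y]] ys xy
      by (simp add: algebra_simps)
    moreover have "?g integrable_on {x..y}"
      using int by (rule integrable_subinterval_real) (use ys in auto)
    ultimately show ?thesis
      by (metis integrable_integral)
  qed
qed

text \<open>The curve \<open>\<Phi> u s *v v\<close> is the solution through \<open>v\<close> at
  time \<open>s\<close>; the doubling bound compares its values at the two ends of the interval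
  between \<open>s\<close> and \<open>t\<close>.\<close>

lemma evolution_operator_norm_ge_half:
  fixes B :: "real \<Rightarrow> real^'n^'n"
  assumes ev: "evolution_operator B \<Phi>"
    and bound: "\<And>u x. norm (B u *v x) \<le> C * norm x"
    and C: "0 \<le> C" "C * \<bar>t - s\<bar> \<le> 1/2"
  shows "norm v \<le> 2 * norm (\<Phi> t s *v v)"
proof -
  define f where "f = (\<lambda>u. \<Phi> u s *v v)"
  define a b where "a = min s t" and "b = max s t"
  have lin: "bounded_linear (\<lambda>A :: real^'n^'n. A *v v)"
    by (intro linear_conv_bounded_linear[THEN iffD1] linearI)
      (auto simp: matrix_vector_mult_add_rdistrib scaleR_matrix_vector_assoc)
  have "((\<lambda>u. B u *v f u) has_integral (f y - f x)) {x..y}" if "a \<le> x" "x \<le> y" "y \<le> b" for x y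
  proof -
    \<comment> \<open>\<open>s\<close> is an end point of \<open>{a..b}\<close>, so it is never
      interior to \<open>{x..y}\<close>.\<close>
    have "s \<le> x \<or> y \<le> s"
      using that unfolding a_def b_def by linarith
    from has_integral_linear[OF evolution_operator_increment[OF ev \<open>x \<le> y\<close> this] lin]
    show ?thesis
      by (simp add: f_def o_def matrix_vector_mul_assoc matrix_vector_mult_diff_rdistrib)
  qed
  then have "norm (f s) \<le> 2 * norm (f t)"
    by (rule solution_norm_le_double[where a = a and b = b and C = C])
      (use bound C in \<open>auto simp: a_def b_def min_def max_def abs_if split: if_split_asm\<close>)
  then show ?thesis
    by (simp add: f_def evolution_operator_refl[OF ev])
qed

text \<open>A vector \<open>w = P *v v\<close> is fixed by \<open>P\<close>, so \<open>A\<close>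
  acts on it as \<open>A ** P\<close>. If \<open>w\<close> were nonzero, the two bounds would give
  \<open>norm w < norm w\<close>.\<close>

lemma idempotent_contracted_eq_0:
  fixes A P :: "real^'n^'n"
  assumes idem: "P ** P = P"
    and expand: "\<And>v. norm v \<le> 2 * norm (A *v v)"
    and contract: "onorm ((*v) (A ** P)) < 1/2"
  shows "P = 0"
proof -
  have "P *v v = 0" for v
  proof (rule ccontr)
    assume "P *v v \<noteq> 0"
    have "norm (P *v v) \<le> 2 * norm ((A ** P) *v (P *v v))"
      using expand[of "P *v v"] idem
      by (metis matrix_vector_mul_assoc)
    also have "\<dots> \<le> 2 * (onorm ((*v) (A ** P)) * norm (P *v v))"
      using onorm[OF matrix_vector_mul_bounded_linear] by simp
    also have "\<dots> < 2 * (1/2 * norm (P *v v))"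
      using contract \<open>P *v v \<noteq> 0\<close> by simp
    finally show False by simp
  qed
  then show ?thesis
    by (simp add: matrix_eq)
qed

text \<open>For positive \<open>s\<close> the exponents differ by at least
  \<open>\<delta> * s powr (r - 1)\<close>: split one factor off each power and use monotonicity of
  the remaining power. This is unbounded because \<open>r > 1\<close>.\<close>

lemma s_rate_quotient_at_top:
  assumes r: "r > 1" and \<delta>: "\<delta> > 0"
  shows "filterlim (\<lambda>s. s_rate r (s + \<delta>) / s_rate r s) at_top at_top"
proof (rule filterlim_at_top_mono)
  show "filterlim (\<lambda>s. exp (\<delta> * s powr (r - 1))) at_top at_top"
    using r \<delta>
    by (intro filterlim_compose[OF exp_at_top] filterlim_tendsto_pos_mult_at_top[OF tendsto_const]
        real_powr_at_top) auto
  show "\<forall>\<^sub>F s in at_top. exp (\<delta> * s powr (r - 1)) \<le> s_rate r (s + \<delta>) / s_rate r s"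
    using eventually_gt_at_top[of 0]
  proof eventually_elim
    case (elim s)
    have "s powr r + \<delta> * s powr (r - 1) = (s + \<delta>) * s powr (r - 1)"
      using elim by (simp add: powr_diff field_simps)
    also have "\<dots> \<le> (s + \<delta>) * (s + \<delta>) powr (r - 1)"
      using elim r \<delta> by (intro mult_left_mono powr_mono2) auto
    also have "\<dots> = (s + \<delta>) powr r"
      using elim \<delta> by (simp add: powr_diff)
    finally show ?case
      using elim \<delta> by (simp add: s_rate_def exp_diff[symmetric])
  qed
qed

lemma fast_growth_rate_quotient_at_top:
  assumes "fast_growth_rate \<mu>" and \<delta>: "\<delta> > 0"
  shows "filterlim (\<lambda>s. \<mu> (s + \<delta>) / \<mu> s) at_top at_top"
proof -
  obtain r M where r: "r > 1" and M: "M \<ge> 1"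
    and le: "\<And>s t. s \<le> t \<Longrightarrow> s_rate r t / s_rate r s \<le> M * (\<mu> t / \<mu> s)"
    using assms(1) unfolding fast_growth_rate_def by blast
  have "filterlim (\<lambda>s. (1 / M) * (s_rate r (s + \<delta>) / s_rate r s)) at_top at_top"
    using M by (intro filterlim_tendsto_pos_mult_at_top[OF tendsto_const _
          s_rate_quotient_at_top[OF r \<delta>]]) auto
  then show ?thesis
  proof (rule filterlim_at_top_mono, intro always_eventually allI)
    fix s
    show "1 / M * (s_rate r (s + \<delta>) / s_rate r s) \<le> \<mu> (s + \<delta>) / \<mu> s"
      using mult_left_mono[OF le[of s "s + \<delta>"], of "1 / M"] M \<delta> by simp
  qed
qed

text \<open>This is the dynamical core; compactness of the base space will supply the boundedness of
  the coefficient along an orbit.\<close>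

lemma bounded_not_fast_dichotomy:
  fixes B :: "real \<Rightarrow> real^'n^'n"
  assumes bdd: "bounded (range B)" and fast: "fast_growth_rate \<mu>"
  shows "\<not> mu_dichotomy \<mu> B"
proof
  assume "mu_dichotomy \<mu> B"
  then obtain \<Phi> P K \<alpha> \<beta> where ev: "evolution_operator B \<Phi>"
    and idem: "\<And>s. P s ** P s = P s"
    and \<alpha>: "\<alpha> < 0" and \<beta>: "\<beta> > 0"
    and stable: "\<And>t s. s \<le> t \<Longrightarrow> onorm ((*v) (\<Phi> t s ** P s)) \<le> K * (\<mu> t / \<mu> s) powr \<alpha>"
    and unstable: "\<And>t s. t \<le> s \<Longrightarrow> onorm ((*v) (\<Phi> t s ** (mat 1 - P s))) \<le> K * (\<mu> t / \<mu> s) powr \<beta>"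
    unfolding mu_dichotomy_def by blast
  have \<mu>pos: "\<mu> t > 0" for t
    using fast by (simp add: fast_growth_rate_def growth_rate_def)
  obtain b where b: "b > 0" "\<And>t. norm (B t) \<le> b"
    using bdd unfolding bounded_pos by auto
  \<comment> \<open>The factor counts the matrix entries: it turns the entrywise bound
    \<open>b\<close> into a bound on the operator norm.\<close>
  define C where "C = real CARD('n) * real CARD('n) * b"
  have C: "C > 0"
    using b by (simp add: C_def)
  have bound: "norm (B u *v x) \<le> C * norm x" for u x
  proof -
    have "\<bar>B u $ i $ j\<bar> \<le> b" for i j
      using component_le_norm_cart[of "B u $ i" j] Finite_Cartesian_Product.norm_nth_le[of "B u" i] b(2)[of u]
      by linarith
    then have "onorm ((*v) (B u)) \<le> C"
      unfolding C_def by (rule onorm_le_matrix_component)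
    then show ?thesis
      by (rule order_trans[OF onorm[OF matrix_vector_mul_bounded_linear] mult_right_mono]) simp
  qed
  define \<delta> where "\<delta> = 1 / (2 * C)"
  have \<delta>: "\<delta> > 0" "C * \<delta> \<le> 1/2"
    using C by (auto simp: \<delta>_def)
  have expand: "norm v \<le> 2 * norm (\<Phi> t s *v v)" if "\<bar>t - s\<bar> = \<delta>" for t s v
    using ev bound by (rule evolution_operator_norm_ge_half) (use C \<delta> that in auto)

  let ?q = "\<lambda>s. \<mu> (s + \<delta>) / \<mu> s"
  \<comment> \<open>This is used twice, with \<gamma> = \<alpha> for the range of the projection and
    \<gamma> = -\<beta> for its kernel.\<close>
  have decay: "\<forall>\<^sub>F s in at_top. K * ?q s powr \<gamma> < 1/2" if "\<gamma> < 0" for \<gamma>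
  proof -
    have "((\<lambda>s. K * ?q s powr \<gamma>) \<longlongrightarrow> K * 0) at_top"
      using that fast_growth_rate_quotient_at_top[OF fast \<delta>(1)]
      by (intro tendsto_mult tendsto_const tendsto_neg_powr)
    then show ?thesis
      by (rule order_tendstoD) simp
  qed
  have P0: "\<forall>\<^sub>F s in at_top. P s = 0"
    using decay[OF \<alpha>]
  proof eventually_elim
    case (elim s)
    have "onorm ((*v) (\<Phi> (s + \<delta>) s ** P s)) < 1/2"
      using stable[of s "s + \<delta>"] elim \<delta>(1) by simp
    then show ?case
      using idem expand[of "s + \<delta>" s] \<delta>(1) by (intro idempotent_contracted_eq_0) auto
  qed
  have P1: "\<forall>\<^sub>F s in at_top. mat 1 - P (s + \<delta>) = 0"
    using decay[of "-\<beta>", simplified, OF \<beta>]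
  proof eventually_elim
    case (elim s)
    \<comment> \<open>The backward step starts at \<open>s + \<delta>\<close>, so the quotient is
      inverted and the exponent changes sign.\<close>
    have "(\<mu> s / \<mu> (s + \<delta>)) powr \<beta> = ?q s powr (- \<beta>)"
      using \<mu>pos[of s] \<mu>pos[of "s + \<delta>"] by (simp add: powr_minus powr_divide)
    then have "onorm ((*v) (\<Phi> s (s + \<delta>) ** (mat 1 - P (s + \<delta>)))) < 1/2"
      using unstable[of s "s + \<delta>"] elim \<delta>(1) by simp
    moreover have "(mat 1 - P (s + \<delta>)) ** (mat 1 - P (s + \<delta>)) = mat 1 - P (s + \<delta>)"
      using idem[of "s + \<delta>"]
      by (simp add: matrix_eq matrix_vector_mul_assoc[symmetric] matrix_vector_mult_diff_rdistrib
          matrix_vector_mult_diff_distrib)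
    ultimately show ?case
      using expand[of s "s + \<delta>"] \<delta>(1) by (intro idempotent_contracted_eq_0) auto
  qed
  \<comment> \<open>Shifting by \<delta> brings both statements about the projection to the same
    time.\<close>
  have "\<forall>\<^sub>F s in at_top. P (s + \<delta>) = 0"
    using P0 filterlim_tendsto_add_at_top[OF tendsto_const filterlim_ident, of \<delta>]
    by (auto simp: filterlim_iff add.commute)
  with P1 have "\<forall>\<^sub>F s :: real in at_top. (mat 1 :: real^'n^'n) = 0"
    by eventually_elim simp
  then have "(mat 1 :: real^'n^'n) = 0"
    by simp
  then have "(mat 1 :: real^'n^'n) $ i $ i = 0" for i
    by simp
  then show False
    by (simp add: mat_def)
qed

theorem corollary4p4:
  fixes X :: "(real \<Rightarrow> real^'n^'n) topology"
  assumes "base_space X"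
  shows "(\<forall>\<omega> \<in> topspace X. \<forall>\<mu>. fast_growth_rate \<mu> \<longrightarrow>
            (mu_dichotomy \<mu> (\<lambda>t. eval0 (translate t \<omega>)) \<longleftrightarrow> 0 \<notin> mu_spectrum \<mu> \<omega>)) \<and>
         ((\<exists>\<omega> \<in> topspace X. \<exists>\<mu>. fast_growth_rate \<mu> \<and>
            mu_dichotomy \<mu> (\<lambda>t. eval0 (translate t \<omega>))) \<longrightarrow>
          \<not> compact_space X)"
proof (intro conjI impI)
  show "\<forall>\<omega> \<in> topspace X. \<forall>\<mu>. fast_growth_rate \<mu> \<longrightarrow>
      (mu_dichotomy \<mu> (\<lambda>t. eval0 (translate t \<omega>)) \<longleftrightarrow> 0 \<notin> mu_spectrum \<mu> \<omega>)"
    \<comment> \<open>For \<gamma> = 0 the shift vanishes, and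
      \<open>eval0 (translate t \<omega>)\<close> is \<open>\<omega> t\<close>, so both sides
      concern the same equation.\<close>
    by (simp add: mu_spectrum_def eval0_def translate_def)
next
  assume "\<exists>\<omega> \<in> topspace X. \<exists>\<mu>. fast_growth_rate \<mu> \<and>
      mu_dichotomy \<mu> (\<lambda>t. eval0 (translate t \<omega>))"
  then obtain \<omega> \<mu> where \<omega>: "\<omega> \<in> topspace X" and fast: "fast_growth_rate \<mu>"
    and dich: "mu_dichotomy \<mu> (\<lambda>t. eval0 (translate t \<omega>))"
    by blast
  show "\<not> compact_space X"
  proof
    assume "compact_space X"
    moreover have "continuous_map X euclidean (eval0 :: _ \<Rightarrow> real^'n^'n)"
      using assms by (simp add: base_space_def)
    ultimately have "compact (eval0 ` topspace X)"
      using image_compactin[of X "topspace X" euclidean eval0]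
      by (simp add: compact_space_def)
    then have "bounded (eval0 ` topspace X)"
      by (rule compact_imp_bounded)
    \<comment> \<open>A continuous map sends carrier to carrier, so continuity of the flow includes
      the invariance of the base space.\<close>
    moreover have "translate t \<omega> \<in> topspace X" for t
    proof -
      have "continuous_map (prod_topology euclideanreal X) X (\<lambda>(\<tau>, \<omega>). translate \<tau> \<omega>)"
        using assms by (simp add: base_space_def)
      from continuous_map_funspace[OF this] \<omega> show ?thesis
        by (force simp: Pi_iff)
    qed
    ultimately have "bounded (range (\<lambda>t. eval0 (translate t \<omega>)))"
      by (auto elim: bounded_subset)
    with fast dich show False
      using bounded_not_fast_dichotomy by blast
  qed
qed

end
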